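(* If $A,B\in\mathbb{C}^{n\times n}$ are normal matrices, then for any $\lambda\in\mathbb{C}$ and any real $\epsilon\ge0$, $$\left|\dim\mathcal{R}(A,\lambda,\epsilon)-\dim\mathcal{R}(B,\lambda,\epsilon)\right|\le\operatorname{rank}(A-B).$$
   Context: A vector $x$ is an $\alpha$-eigenvector of $A$ if $Ax=\alpha x$. $\mathcal{R}(A,\lambda,\epsilon)$ denotes the linear subspace of $\mathbb{C}^n$ spanned by all $\alpha$-eigenvectors of $A$ over all $\alpha\in\mathbb{C}$ with $|\lambda-\alpha|\le\epsilon$. *)

theory Defs
  imports "HOL-Analysis.Analysis"
begin

definition conj_transpose :: "complex^'n^'m \<Rightarrow> complex^'m^'n" where
  "conj_transpose A = (\<chi> i j. cnj (A $ j $ i))"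

definition normal_matrix :: "complex^'n^'n \<Rightarrow> bool" where
  "normal_matrix A \<longleftrightarrow> A ** conj_transpose A = conj_transpose A ** A"

text \<open>The zero vector counts as an \<open>\<alpha>\<close>-eigenvector for every \<open>\<alpha>\<close>; this does not affect spans.\<close>

definition is_eigenvector :: "complex^'n^'n \<Rightarrow> complex \<Rightarrow> complex^'n \<Rightarrow> bool" where
  "is_eigenvector A \<alpha> x \<longleftrightarrow> A *v x = \<alpha> *s x"

text \<open>Here \<^const>\<open>vec.span\<close> is the span over the complex numbers. The unqualified
  \<^const>\<open>span\<close> and \<^const>\<open>dim\<close> would refer to the real vector space structure.\<close>

definition eigen_span :: "complex^'n^'n \<Rightarrow> complex \<Rightarrow> real \<Rightarrow> (complex^'n) set" where
  "eigen_span A l \<epsilon> = vec.span {x. \<exists>\<alpha>. cmod (l - \<alpha>) \<le> \<epsilon> \<and> is_eigenvector A \<alpha> x}"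

end

theory Submission
  imports Defs "HOL-Computational_Algebra.Fundamental_Theorem_Algebra"
begin

text \<open>Let \<open>V\<close> be the span of the eigenvectors of \<open>A\<close> with eigenvalue within \<open>\<epsilon>\<close> of \<open>l\<close>, and \<open>W\<close> the
  span of the eigenvectors of \<open>B\<close> with eigenvalue further than \<open>\<epsilon>\<close> from \<open>l\<close>. Eigenvectors of a normal
  matrix for distinct eigenvalues are orthogonal, so \<open>A - l\<close> stretches the vectors in \<open>V\<close> by at most
  \<open>\<epsilon>\<close>, while \<open>B - l\<close> stretches the nonzero vectors in \<open>W\<close> by more than \<open>\<epsilon>\<close>. Hence \<open>A - B\<close> is injective
  on \<open>V \<inter> W\<close>, whose dimension is therefore at most the rank of \<open>A - B\<close>; by the spectral theorem \<open>W\<close>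
  has codimension at most the dimension of the eigenvector span of \<open>B\<close>.

  Throughout, \<^const>\<open>inner\<close> is the real inner product, the real part of the Hermitian one. For complex
  subspaces both give the same orthogonal complement.\<close>

section \<open>Rank and dimension inequalities over a field\<close>

lemma dim_range_le_rank:
  fixes M :: "'a::field^'n^'m"
  shows "vec.dim (range ((*v) M)) \<le> rank M"
proof -
  obtain R where R: "R \<subseteq> rows M" "vec.independent R" "rows M \<subseteq> vec.span R" "card R = vec.dim (rows M)"
    using vec.basis_exists[of "rows M"] by blast
  have fin: "finite R"
    using R(2) vec.finiteI_independent by blast
  have "\<exists>c. row i M = (\<Sum>b\<in>R. c b *s b)" for i
  proof -
    have "row i M \<in> vec.span R"
      using R(3) by (auto simp: rows_def)
    then show ?thesis
      unfolding vec.span_finite[OF fin] by auto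
  qed
  then obtain c where c: "\<And>i. row i M = (\<Sum>b\<in>R. c i b *s b)"
    by metis
  \<comment> \<open>Expressing each row in the basis \<open>R\<close> factors \<open>M\<close>
    through the row space. The columns of the left factor, at most \<open>card R\<close> many, span
    the range.\<close>
  let ?C = "(\<lambda>b. \<chi> i. c i b) ` R"
  have "M *v x \<in> vec.span ?C" for x
  proof -
    have "M $ i $ j = (\<Sum>b\<in>R. c i b * b $ j)" for i j
      using arg_cong[OF c[of i], of "\<lambda>v. v $ j"] by (simp add: row_def sum_component)
    then have "(M *v x) $ i = (\<Sum>b\<in>R. (\<Sum>j\<in>UNIV. b $ j * x $ j) * c i b)" for i
      by (simp add: matrix_vector_mult_def sum_distrib_right sum_distrib_left
          sum.swap[of _ _ R] mult.assoc mult.commute mult.left_commute)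
    then have "M *v x = (\<Sum>b\<in>R. (\<Sum>j\<in>UNIV. b $ j * x $ j) *s (\<chi> i. c i b))"
      by (simp add: vec_eq_iff sum_component)
    then show ?thesis
      by (simp only:) (rule vec.span_sum, rule vec.span_scale, rule vec.span_base, rule imageI)
  qed
  then have "vec.dim (range ((*v) M)) \<le> card ?C"
    using fin by (intro vec.dim_le_card) auto
  also have "\<dots> \<le> card R"
    using fin by (rule card_image_le)
  finally show ?thesis
    using R(4) by (simp add: row_rank_def_gen)
qed

lemma dim_add_le_dim_Int:
  fixes S T :: "('a::field^'n) set"
  assumes "vec.subspace S" "vec.subspace T"
  shows "vec.dim S + vec.dim T \<le> vec.dim (S \<inter> T) + CARD('n)"
  using vec.dim_sums_Int[OF assms] dim_subset_UNIV_cart_gen[of "{x + y |x y. x \<in> S \<and> y \<in> T}"]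
  by linarith

section \<open>The real inner product and complex linear maps\<close>

lemma inner_smult_left:
  fixes x y :: "complex^'n"
  shows "inner (c *s x) y = inner x (cnj c *s y)"
  unfolding inner_vec_def by (intro sum.cong refl) (simp add: inner_complex_def algebra_simps)

lemma norm_smult:
  fixes x :: "complex^'n"
  shows "norm (c *s x) = cmod c * norm x"
  by (simp add: norm_vec_def norm_mult L2_set_right_distrib)

lemma inner_matrix_left:
  fixes A :: "complex^'n^'m"
  shows "inner (A *v x) y = inner x (conj_transpose A *v y)"
proof -
  have "inner (A *v x) y = (\<Sum>i\<in>UNIV. \<Sum>j\<in>UNIV. inner (A $ i $ j * x $ j) (y $ i))"
    by (simp add: inner_vec_def matrix_vector_mult_def inner_sum_left)
  also have "\<dots> = (\<Sum>j\<in>UNIV. \<Sum>i\<in>UNIV. inner (x $ j) (cnj (A $ i $ j) * y $ i))"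
    by (subst sum.swap) (simp add: inner_complex_def algebra_simps)
  finally show ?thesis
    by (simp add: inner_vec_def matrix_vector_mult_def conj_transpose_def inner_sum_right)
qed

lemma conj_transpose_conj_transpose [simp]: "conj_transpose (conj_transpose A) = A"
  by (simp add: conj_transpose_def vec_eq_iff)

text \<open>Allows the real orthogonal decomposition to be applied to complex subspaces.\<close>

lemma subspace_if_vec_subspace:
  fixes S :: "(complex^'n) set"
  assumes "vec.subspace S"
  shows "subspace S"
proof -
  have "r *\<^sub>R x = complex_of_real r *s x" for r and x :: "complex^'n"
    unfolding vec_eq_iff by (simp add: scaleR_conv_of_real[where 'a = complex])
  with assms show ?thesis
    by (auto simp: subspace_def vec.subspace_def)
qed

section \<open>Polynomials in a matrix, applied to a vector by Horner's scheme\<close>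

definition apply_poly :: "'a::field^'n^'n \<Rightarrow> 'a poly \<Rightarrow> 'a^'n \<Rightarrow> 'a^'n" where
  "apply_poly A p x = fold_coeffs (\<lambda>a v. a *s x + A *v v) p 0"

lemma apply_poly_0 [simp]: "apply_poly A 0 x = 0"
  by (simp add: apply_poly_def)

lemma apply_poly_pCons [simp]: "apply_poly A (pCons a p) x = a *s x + A *v apply_poly A p x"
  by (cases "p = 0 \<and> a = 0") (auto simp: apply_poly_def)

lemma apply_poly_add: "apply_poly A (p + q) x = apply_poly A p x + apply_poly A q x"
  by (induction p q rule: poly_induct2)
    (simp_all add: algebra_simps matrix_vector_right_distrib vec.scale_left_distrib)

lemma apply_poly_smult: "apply_poly A (smult c p) x = c *s apply_poly A p x"
  by (induction p) (simp_all add: vec.scale_right_distrib vector_scalar_commute vector_smult_assoc)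

lemma apply_poly_sum: "apply_poly A (sum p I) x = (\<Sum>i\<in>I. apply_poly A (p i) x)"
  by (induction I rule: infinite_finite_induct) (simp_all add: apply_poly_add)

lemma apply_poly_monom: "apply_poly A (monom c k) x = c *s ((*v) A ^^ k) x"
  by (induction k) (simp_all add: monom_0 monom_Suc vector_scalar_commute)

lemma apply_poly_in_subspace:
  assumes "vec.subspace W" "\<And>v. v \<in> W \<Longrightarrow> A *v v \<in> W" "x \<in> W"
  shows "apply_poly A p x \<in> W"
  using assms by (induction p) (auto simp: vec.subspace_0 vec.subspace_add vec.subspace_scale)

text \<open>The n + 1 iterates x, A x, ..., A^n x are linearly dependent in dimension n. The
  coefficients of a nontrivial relation are those of the polynomial.\<close>

lemma annihilating_poly_exists:
  fixes A :: "'a::field^'n^'n"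
  shows "\<exists>p. p \<noteq> 0 \<and> apply_poly A p x = 0"
\<comment> \<open>Independence is a property of sets, which forget repetitions. If two iterates
  coincide, the polynomial is X^i - X^j instead.\<close>
proof (cases "inj_on (\<lambda>k. ((*v) A ^^ k) x) {..CARD('n)}")
  case True
  let ?f = "\<lambda>k. ((*v) A ^^ k) x"
  have "\<not> vec.independent (?f ` {..CARD('n)})"
  proof
    assume "vec.independent (?f ` {..CARD('n)})"
    then have "card (?f ` {..CARD('n)}) \<le> CARD('n)"
      using vec.dim_eq_card_independent dim_subset_UNIV_cart_gen by metis
    with True show False
      by (simp add: card_image)
  qed
  then obtain u k where u: "k \<le> CARD('n)" "u (?f k) \<noteq> 0"
      "(\<Sum>v\<in>?f ` {..CARD('n)}. u v *s v) = 0"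
    unfolding vec.dependent_finite[OF finite_imageI[OF finite_atMost]] by auto
  let ?p = "\<Sum>k\<le>CARD('n). monom (u (?f k)) k"
  have "coeff ?p k = u (?f k)"
    using u(1) by (simp add: coeff_sum)
  with u(2) have "?p \<noteq> 0"
    by (metis coeff_0)
  moreover have "apply_poly A ?p x = 0"
    using u(3) True by (simp add: apply_poly_sum apply_poly_monom sum.reindex)
  ultimately show ?thesis
    by blast
next
  case False
  then obtain i j where ij: "i \<noteq> j" "((*v) A ^^ i) x = ((*v) A ^^ j) x"
    by (auto simp: inj_on_def)
  let ?p = "monom 1 i + monom (-1) j :: 'a poly"
  have "coeff ?p i = 1"
    using ij(1) by simp
  then have "?p \<noteq> 0"
    by (metis coeff_0 zero_neq_one)
  moreover have "apply_poly A ?p x = 0"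
    using ij(2) by (simp add: apply_poly_add apply_poly_monom)
  ultimately show ?thesis
    by blast
qed

text \<open>Split a root off an annihilating polynomial, p = (X - a) q. Either q(A) x is a nonzero
  \<open>a\<close>-eigenvector, lying in \<open>W\<close> by invariance, or \<open>q\<close>
  annihilates \<open>x\<close> and has smaller degree.\<close>

lemma eigenvector_in_invariant_subspace:
  fixes A :: "complex^'n^'n"
  assumes W: "vec.subspace W" "\<And>v. v \<in> W \<Longrightarrow> A *v v \<in> W" and x: "x \<in> W" "x \<noteq> 0"
  shows "\<exists>\<alpha> v. v \<in> W \<and> v \<noteq> 0 \<and> is_eigenvector A \<alpha> v"
proof -
  have "\<exists>\<alpha> v. v \<in> W \<and> v \<noteq> 0 \<and> is_eigenvector A \<alpha> v"
    if "p \<noteq> 0" "apply_poly A p x = 0" for p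
    using that
  proof (induction "degree p" arbitrary: p rule: less_induct)
    case less
    show ?case
    proof (cases "degree p = 0")
      case True
      then obtain c where "p = [:c:]"
        by (rule degree_eq_zeroE)
      with less.prems x(2) show ?thesis
        by simp
    next
      case False
      then obtain a where "poly p a = 0"
        using fundamental_theorem_of_algebra[of p] constant_degree[of p] by auto
      then obtain q where q: "p = [:-a, 1:] * q"
        by (metis dvdE poly_eq_0_iff_dvd)
      have "q \<noteq> 0"
        using q less.prems(1) by auto
      then have "degree q < degree p"
        unfolding q by (subst degree_mult_eq) auto
      have "p = smult (-a) q + pCons 0 q"
        by (simp add: q)
      with less.prems(2) have "apply_poly A (smult (-a) q + pCons 0 q) x = 0"
        by simp
      then have "A *v apply_poly A q x = a *s apply_poly A q x"
        unfolding apply_poly_add apply_poly_smult by simp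
      then have "is_eigenvector A a (apply_poly A q x)"
        by (simp add: is_eigenvector_def)
      then show ?thesis
        using less.hyps[OF \<open>degree q < degree p\<close> \<open>q \<noteq> 0\<close>] apply_poly_in_subspace[OF W x(1), of q]
        by blast
    qed
  qed
  then show ?thesis
    using annihilating_poly_exists by blast
qed

section \<open>The spectral theorem for normal matrices\<close>

lemma norm_conj_transpose_normal:
  assumes "normal_matrix A"
  shows "norm (conj_transpose A *v x) = norm (A *v x)"
proof -
  have "inner (A *v x) (A *v x) = inner x ((conj_transpose A ** A) *v x)"
    by (simp add: inner_matrix_left matrix_vector_mul_assoc)
  also have "\<dots> = inner (conj_transpose A *v x) (conj_transpose A *v x)"
    using assms
    by (simp add: inner_matrix_left matrix_vector_mul_assoc normal_matrix_def)
  finally show ?thesis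
    by (simp add: norm_eq_sqrt_inner)
qed

text \<open>With \<open>?y\<close> and \<open>?z\<close> of equal norm and
  \<open>inner ?y ?z = inner ?z ?z\<close>, expanding the squared norm of \<open>?y - ?z\<close>
  gives zero.\<close>

lemma normal_eigenvector_conj_transpose:
  assumes "normal_matrix A" "is_eigenvector A \<alpha> x"
  shows "is_eigenvector (conj_transpose A) (cnj \<alpha>) x"
proof -
  let ?y = "conj_transpose A *v x" and ?z = "cnj \<alpha> *s x"
  have "norm ?y = norm ?z"
    using norm_conj_transpose_normal[OF assms(1), of x] assms(2)
    by (simp add: is_eigenvector_def norm_smult)
  moreover have "inner ?y ?z = inner ?z ?z"
    using assms(2)
    by (simp add: inner_matrix_left inner_smult_left is_eigenvector_def vector_scalar_commute
        vector_smult_assoc mult.commute)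
  ultimately have "inner (?y - ?z) (?y - ?z) = 0"
    by (simp add: inner_diff_left inner_diff_right norm_eq inner_commute)
  then show ?thesis
    by (simp add: is_eigenvector_def)
qed

lemma normal_eigenvectors_orthogonal:
  assumes "normal_matrix A" "is_eigenvector A \<alpha> x" "is_eigenvector A \<beta> y" "\<alpha> \<noteq> \<beta>"
  shows "orthogonal x y"
proof -
  txt \<open>Real orthogonality gives only \<open>inner ((\<alpha> - \<beta>) *s u) y = 0\<close>, so the factor is divided out beforehand.\<close>
  define u where "u = (1 / (\<alpha> - \<beta>)) *s x"
  have "is_eigenvector A \<alpha> u"
    using assms(2)
    by (simp add: u_def is_eigenvector_def vector_scalar_commute vector_smult_assoc mult.commute)
  then have "inner (\<alpha> *s u) y = inner u (conj_transpose A *v y)"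
    by (simp add: is_eigenvector_def flip: inner_matrix_left)
  also have "\<dots> = inner (\<beta> *s u) y"
    using normal_eigenvector_conj_transpose[OF assms(1,3)]
    by (simp add: is_eigenvector_def inner_smult_left)
  finally have "inner ((\<alpha> - \<beta>) *s u) y = 0"
    by (simp add: vec.scale_left_diff_distrib inner_diff_left)
  then show ?thesis
    using assms(4) by (simp add: u_def vector_smult_assoc orthogonal_def)
qed

text \<open>The span \<open>E\<close> of the eigenvectors is invariant under the conjugate
  transpose, so its orthogonal complement \<open>W\<close> is invariant under \<open>A\<close>. If
  \<open>W\<close> were nonzero it would contain an eigenvector of \<open>A\<close>, which would be
  orthogonal to itself.\<close>

lemma span_eigenvectors_normal:
  fixes A :: "complex^'n^'n"
  assumes "normal_matrix A"
  shows "vec.span {x. \<exists>\<alpha>. is_eigenvector A \<alpha> x} = UNIV"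
proof -
  define E where "E = vec.span {x. \<exists>\<alpha>. is_eigenvector A \<alpha> x}"
  define W where "W = {x. \<forall>y\<in>E. inner x y = 0}"
  have E: "vec.subspace E"
    by (simp add: E_def)
  have E_inv: "conj_transpose A *v y \<in> E" if "y \<in> E" for y
    using that unfolding E_def
  proof (induction rule: vec.span_induct_alt)
    case base
    show ?case
      by (simp add: vec.span_zero)
  next
    case (step c x y)
    then obtain \<alpha> where \<alpha>: "is_eigenvector A \<alpha> x"
      by blast
    then have "conj_transpose A *v x = cnj \<alpha> *s x"
      using normal_eigenvector_conj_transpose[OF assms] by (simp add: is_eigenvector_def)
    moreover have "x \<in> vec.span {x. \<exists>\<alpha>. is_eigenvector A \<alpha> x}"
      using step(1) by (rule vec.span_base)
    ultimately show ?case
      using step(2)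
      by (simp only: matrix_vector_right_distrib vector_scalar_commute vec.span_add vec.span_scale)
  qed
  \<comment> \<open>A complex scalar moves, conjugated, to the other argument of
    \<open>inner\<close>, where \<open>E\<close> absorbs it.\<close>
  have W: "vec.subspace W"
    using E by (auto simp: W_def vec.subspace_def inner_add_left inner_smult_left)
  have W_inv: "A *v x \<in> W" if "x \<in> W" for x
    using that E_inv by (auto simp: W_def inner_matrix_left)
  have W_0: "x = 0" if "x \<in> W" for x
  proof (rule ccontr)
    assume "x \<noteq> 0"
    then obtain \<alpha> v where v: "v \<in> W" "v \<noteq> 0" "is_eigenvector A \<alpha> v"
      using eigenvector_in_invariant_subspace[OF W W_inv \<open>x \<in> W\<close>] by blast
    then have "v \<in> E"
      by (auto simp: E_def intro: vec.span_base)
    with v show False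
      by (auto simp: W_def)
  qed
  have "x \<in> E" for x
  proof -
    obtain y z where yz: "y \<in> span E" "\<And>w. w \<in> span E \<Longrightarrow> orthogonal z w" "x = y + z"
      using orthogonal_subspace_decomp_exists[of E x] by metis
    then have "z \<in> W"
      by (auto simp: W_def orthogonal_def span_base)
    then have "x = y"
      using W_0 yz(3) by simp
    with yz(1) show ?thesis
      using subspace_if_vec_subspace[OF E] by (metis span_eq_iff)
  qed
  then show ?thesis
    by (auto simp: E_def)
qed

section \<open>Norm bounds on spans of eigenvectors\<close>

lemma span_eigenvectors_decomp:
  assumes "x \<in> vec.span {x. \<exists>\<alpha>\<in>\<Lambda>. is_eigenvector A \<alpha> x}"
  shows "\<exists>F f. finite F \<and> F \<subseteq> \<Lambda> \<and> (\<forall>\<alpha>. is_eigenvector A \<alpha> (f \<alpha>)) \<and>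
    (\<forall>\<alpha>. \<alpha> \<notin> F \<longrightarrow> f \<alpha> = 0) \<and> x = sum f F"
  using assms
proof (induction rule: vec.span_induct_alt)
  case base
  show ?case
    by (rule exI[of _ "{}"], rule exI[of _ "\<lambda>_. 0"]) (simp add: is_eigenvector_def)
next
  case (step c x y)
  then obtain F f \<alpha> where F: "finite F" "F \<subseteq> \<Lambda>" "\<And>\<alpha>. is_eigenvector A \<alpha> (f \<alpha>)"
      "\<And>\<alpha>. \<alpha> \<notin> F \<Longrightarrow> f \<alpha> = 0" "y = sum f F" and \<alpha>: "\<alpha> \<in> \<Lambda>" "is_eigenvector A \<alpha> x"
    by blast
  \<comment> \<open>Eigenvectors with the same eigenvalue are merged, so that distinct summands are
    orthogonal when the matrix is normal. The default \<open>f \<alpha> = 0\<close> outside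
    \<open>F\<close> lets one update cover old and new eigenvalues alike.\<close>
  let ?f = "f(\<alpha> := c *s x + f \<alpha>)"
  have "sum f (insert \<alpha> F) = y"
    unfolding F(5) using F(1,4) by (auto simp: sum.insert_if)
  moreover have "sum ?f (insert \<alpha> F) = c *s x + sum f (insert \<alpha> F)"
    using F(1) by (simp add: sum.insert_remove add.assoc)
  moreover have "is_eigenvector A \<beta> (?f \<beta>)" for \<beta>
    using F(3)[of \<beta>] \<alpha>(2)
    by (auto simp: is_eigenvector_def matrix_vector_right_distrib vector_scalar_commute
        vec.scale_right_distrib vec.scale_left_commute vector_smult_assoc mult.commute)
  ultimately show ?case
    using F \<alpha> by (intro exI[of _ "insert \<alpha> F"] exI[of _ ?f]) auto
qed

lemma norm_sum_eigenvectors_normal: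
  assumes "normal_matrix A" "finite F" "\<And>\<alpha>. is_eigenvector A \<alpha> (f \<alpha>)"
  shows "(norm (sum f F))\<^sup>2 = (\<Sum>\<alpha>\<in>F. (norm (f \<alpha>))\<^sup>2)"
proof (rule norm_sum_Pythagorean[OF assms(2)])
  show "pairwise (\<lambda>\<alpha> \<beta>. orthogonal (f \<alpha>) (f \<beta>)) F"
    using normal_eigenvectors_orthogonal[OF assms(1) assms(3) assms(3)]
    by (simp add: pairwise_def)
qed

text \<open>\<open>A - l\<close> only rescales each summand, so the images are again eigenvectors
  for distinct eigenvalues and Pythagoras applies to them.\<close>

lemma norm_shifted_sum_eigenvectors_normal:
  assumes "normal_matrix A" "finite F" "\<And>\<alpha>. is_eigenvector A \<alpha> (f \<alpha>)"
  shows "(norm (A *v sum f F - l *s sum f F))\<^sup>2 = (\<Sum>\<alpha>\<in>F. (cmod (l - \<alpha>))\<^sup>2 * (norm (f \<alpha>))\<^sup>2)"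
proof -
  let ?g = "\<lambda>\<alpha>. (\<alpha> - l) *s f \<alpha>"
  have "A *v f \<alpha> - l *s f \<alpha> = ?g \<alpha>" for \<alpha>
    using assms(3)[of \<alpha>] by (simp add: is_eigenvector_def vec.scale_left_diff_distrib)
  moreover have "A *v sum f F = (\<Sum>\<alpha>\<in>F. A *v f \<alpha>)"
    by (rule linear_sum) simp
  ultimately have "A *v sum f F - l *s sum f F = sum ?g F"
    by (simp add: vec.scale_sum_right flip: sum_subtractf)
  moreover have "is_eigenvector A \<alpha> (?g \<alpha>)" for \<alpha>
    using assms(3)[of \<alpha>]
    by (simp add: is_eigenvector_def matrix_vector_mult_diff_distrib vector_scalar_commute
        vec.scale_right_diff_distrib vector_smult_assoc mult.commute)
  then have "(norm (sum ?g F))\<^sup>2 = (\<Sum>\<alpha>\<in>F. (norm (?g \<alpha>))\<^sup>2)"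
    by (rule norm_sum_eigenvectors_normal[OF assms(1,2)])
  moreover have "norm (?g \<alpha>) = cmod (l - \<alpha>) * norm (f \<alpha>)" for \<alpha>
    by (simp only: norm_smult norm_minus_commute)
  ultimately show ?thesis
    by (simp only: power_mult_distrib)
qed

lemma norm_le_on_eigen_span:
  assumes "normal_matrix A" "\<epsilon> \<ge> 0" "x \<in> eigen_span A l \<epsilon>"
  shows "norm (A *v x - l *s x) \<le> \<epsilon> * norm x"
proof -
  have "x \<in> vec.span {x. \<exists>\<alpha>\<in>{\<alpha>. cmod (l - \<alpha>) \<le> \<epsilon>}. is_eigenvector A \<alpha> x}"
    using assms(3) by (simp add: eigen_span_def)
  from span_eigenvectors_decomp[OF this] obtain F f where
    F: "finite F" "F \<subseteq> {\<alpha>. cmod (l - \<alpha>) \<le> \<epsilon>}" "\<And>\<alpha>. is_eigenvector A \<alpha> (f \<alpha>)" "x = sum f F"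
    by blast
  have "(\<Sum>\<alpha>\<in>F. (cmod (l - \<alpha>))\<^sup>2 * (norm (f \<alpha>))\<^sup>2) \<le> (\<Sum>\<alpha>\<in>F. \<epsilon>\<^sup>2 * (norm (f \<alpha>))\<^sup>2)"
    using F(2) by (intro sum_mono mult_right_mono power_mono) auto
  then have "(norm (A *v x - l *s x))\<^sup>2 \<le> (\<epsilon> * norm x)\<^sup>2"
    using norm_sum_eigenvectors_normal[OF assms(1) F(1,3)]
      norm_shifted_sum_eigenvectors_normal[OF assms(1) F(1,3)] F(4)
    by (simp add: power_mult_distrib sum_distrib_left)
  then show ?thesis
    by (rule power2_le_imp_le) (simp add: assms(2))
qed

lemma norm_greater_on_far_eigen_span:
  assumes "normal_matrix A" "\<epsilon> \<ge> 0" "x \<noteq> 0"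
    and "x \<in> vec.span {x. \<exists>\<alpha>\<in>{\<alpha>. \<epsilon> < cmod (l - \<alpha>)}. is_eigenvector A \<alpha> x}"
  shows "\<epsilon> * norm x < norm (A *v x - l *s x)"
proof -
  from span_eigenvectors_decomp[OF assms(4)] obtain F f where
    F: "finite F" "F \<subseteq> {\<alpha>. \<epsilon> < cmod (l - \<alpha>)}" "\<And>\<alpha>. is_eigenvector A \<alpha> (f \<alpha>)" "x = sum f F"
    by blast
  \<comment> \<open>Zero summands contribute equally to both sides; a nonzero one is what makes the
    comparison of sums strict.\<close>
  obtain \<beta> where "\<beta> \<in> F" "f \<beta> \<noteq> 0"
    using F(4) assms(3) by (metis sum.neutral)
  then have "\<epsilon>\<^sup>2 * (norm (f \<beta>))\<^sup>2 < (cmod (l - \<beta>))\<^sup>2 * (norm (f \<beta>))\<^sup>2"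
    using F(2) assms(2) by (intro mult_strict_right_mono power_strict_mono) auto
  moreover have "\<epsilon>\<^sup>2 * (norm (f \<alpha>))\<^sup>2 \<le> (cmod (l - \<alpha>))\<^sup>2 * (norm (f \<alpha>))\<^sup>2" if "\<alpha> \<in> F" for \<alpha>
    using F(2) assms(2) that by (intro mult_right_mono power_mono) auto
  ultimately have "(\<Sum>\<alpha>\<in>F. \<epsilon>\<^sup>2 * (norm (f \<alpha>))\<^sup>2) < (\<Sum>\<alpha>\<in>F. (cmod (l - \<alpha>))\<^sup>2 * (norm (f \<alpha>))\<^sup>2)"
    using F(1) \<open>\<beta> \<in> F\<close> by (intro sum_strict_mono_ex1) auto
  then have "(\<epsilon> * norm x)\<^sup>2 < (norm (A *v x - l *s x))\<^sup>2"
    using norm_sum_eigenvectors_normal[OF assms(1) F(1,3)]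
      norm_shifted_sum_eigenvectors_normal[OF assms(1) F(1,3)] F(4)
    by (simp add: power_mult_distrib sum_distrib_left)
  then show ?thesis
    by (rule power2_less_imp_less) simp
qed

section \<open>The dimension count\<close>

lemma dim_eigen_span_le:
  fixes A B M :: "complex^'n^'n"
  assumes "normal_matrix A" "normal_matrix B" "\<epsilon> \<ge> 0"
    and M: "\<And>x. M *v x = 0 \<Longrightarrow> A *v x = B *v x"
  shows "vec.dim (eigen_span A l \<epsilon>) \<le> vec.dim (eigen_span B l \<epsilon>) + rank M"
proof -
  let ?V = "eigen_span A l \<epsilon>" and ?U = "eigen_span B l \<epsilon>"
  let ?W = "vec.span {x. \<exists>\<alpha>\<in>{\<alpha>. \<epsilon> < cmod (l - \<alpha>)}. is_eigenvector B \<alpha> x}"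
  have sub: "vec.subspace ?V" "vec.subspace ?U" "vec.subspace ?W"
    by (simp_all add: eigen_span_def)
  have "{x. \<exists>\<alpha>. is_eigenvector B \<alpha> x} = {x. \<exists>\<alpha>. cmod (l - \<alpha>) \<le> \<epsilon> \<and> is_eigenvector B \<alpha> x} \<union>
      {x. \<exists>\<alpha>\<in>{\<alpha>. \<epsilon> < cmod (l - \<alpha>)}. is_eigenvector B \<alpha> x}"
    by (auto simp: not_less) (meson not_less)
  then have "{x + y |x y. x \<in> ?U \<and> y \<in> ?W} = UNIV"
    using span_eigenvectors_normal[OF assms(2)]
    by (simp add: eigen_span_def vec.span_Un)
  then have UW: "CARD('n) \<le> vec.dim ?U + vec.dim ?W"
    using vec.dim_sums_Int[OF sub(2,3)] vec.dim_UNIV[where 'a = complex and 'b = 'n]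
    by (simp add: card_cart_basis)
  have VW: "vec.subspace (?V \<inter> ?W)"
    using sub by (simp add: vec.subspace_inter)
  \<comment> \<open>A kernel vector of \<open>M\<close> satisfies \<open>A *v x = B *v x\<close>, so
    for nonzero \<open>x\<close> the bounds on \<open>?V\<close> and \<open>?W\<close> would
    contradict each other.\<close>
  have ker: "x = 0" if "x \<in> ?V \<inter> ?W" "M *v x = 0" for x
    using that M[of x] norm_le_on_eigen_span[OF assms(1,3), of x l]
      norm_greater_on_far_eigen_span[OF assms(2,3), of x l]
    by fastforce
  have "inj_on ((*v) M) (?V \<inter> ?W)"
  proof (rule inj_onI)
    fix x y assume "x \<in> ?V \<inter> ?W" "y \<in> ?V \<inter> ?W" "M *v x = M *v y"
    then show "x = y"
      using ker[of "x - y"] vec.subspace_diff[OF VW]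
      by (simp add: matrix_vector_mult_diff_distrib)
  qed
  then have "vec.dim ((*v) M ` (?V \<inter> ?W)) = vec.dim (?V \<inter> ?W)"
    using vec.span_eq_iff[THEN iffD2, OF VW]
    by (intro vec.dim_image_eq matrix_vector_mul_linear_gen) (simp only:)
  moreover have "vec.dim ((*v) M ` (?V \<inter> ?W)) \<le> vec.dim (range ((*v) M))"
    by (intro vec.dim_subset) auto
  ultimately have "vec.dim (?V \<inter> ?W) \<le> rank M"
    using dim_range_le_rank[of M] by linarith
  \<comment> \<open>Adding the two inequalities cancels both \<open>CARD('n)\<close> and the
    dimension of \<open>?W\<close>.\<close>
  with UW dim_add_le_dim_Int[OF sub(1,3)] show ?thesis
    by linarith
qed

theorem theorem3:
  fixes A B :: "complex^'n^'n" and l :: complex and \<epsilon> :: real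
  assumes "normal_matrix A" and "normal_matrix B" and "\<epsilon> \<ge> 0"
  shows "\<bar>int (vec.dim (eigen_span A l \<epsilon>)) - int (vec.dim (eigen_span B l \<epsilon>))\<bar> \<le> int (rank (A - B))"
proof -
  \<comment> \<open>The conclusion is symmetric in \<open>A\<close> and \<open>B\<close>, so the one
    matrix \<open>A - B\<close> serves for both directions and its rank need not be compared with
    that of \<open>B - A\<close>.\<close>
  have "(A - B) *v x = 0 \<Longrightarrow> A *v x = B *v x" for x
    by (simp add: matrix_vector_mult_diff_rdistrib)
  then show ?thesis
    using dim_eigen_span_le[OF assms, of "A - B" l] dim_eigen_span_le[OF assms(2,1,3), of "A - B" l]
    by fastforce
qed

end
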